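(* Let $T>0$, $x\in\mathbb{R}\times\mathbb{C}$, $v\in\mathbb{R}\times\mathbb{C}$. Let $f:\mathbb{R}\times\mathbb{C}\to\mathbb{R}$ be a bounded $\mathcal{C}^1$ function with bounded derivative. Denote by $P_T$ the semigroup of the kinetic Brownian motion at time $T$ and by $\delta$ a Malliavin duality operator. If $h=h(x,v,T)$ is in the domain of $\delta$ and satisfies $$J_T^xv+\mathcal{D}X_T^x(h)=0,$$ then $$(d_xP_Tf,v)=-\mathbb{E}\left[f(X_T^x)\,\delta h\right].$$
   Context: $\mathbb{C}$ is identified with $\mathbb{R}^2$, elements of $\mathbb{R}\times\mathbb{C}$ are column vectors; $(d_xg,v)$ is the differential of $g$ at $x$ in direction $v$. Let $(B_t)_{t\ge0}$ be a standard real Brownian motion started at $0$. The kinetic Brownian motion on $\mathbb{R}\times\mathbb{C}$ started at $x=\binom uz$ is $X_t^x=\binom{U_t}{Z_t}$ with $U_t=u+B_t$, $Z_t=z+e^{iu}\int_0^te^{iB_s}ds$, and $P_Tf(x)=\mathbb{E}[f(X_T^x)]$. The tangent flow is $J_T^xv=\left.\frac{d}{da}\right|_{a=0}X_T^{x+av}=\begin{pmatrix}v_0\\ v_z+iv_0e^{iu}\int_0^Te^{iB_s}ds\end{pmatrix}$ for $v=\binom{v_0}{v_z}\in\mathbb{R}\times\mathbb{C}$. Let $H=L^2([0,T],\mathbb{R})$. The Malliavin derivative of $X_T^x$ in the (possibly random) direction $h\in H$ is $\mathcal{D}X_T^x(h)=\begin{pmatrix}\int_0^Th(t)\,dt\\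 ie^{iu}\int_0^Te^{iB_t}\int_0^th(s)\,ds\,dt\end{pmatrix}$. A random $h\in H$ is in the domain of $\delta$, with dual $\delta h$ (an integrable real random variable), if $\mathbb{E}[(d_{X_T^x}f,\mathcal{D}X_T^x(h))]=\mathbb{E}[f(X_T^x)\,\delta h]$ for every bounded $\mathcal{C}^1$ function $f:\mathbb{R}\times\mathbb{C}\to\mathbb{R}$ with bounded derivative. *)

theory Defs
  imports "HOL-Probability.Probability"
begin

text \<open>Every path is required to be continuous and to start at \<open>0\<close>, not only almost every one:
  functionals of the path, such as its time integral, are then measurable without any
  completeness assumption on the probability space.\<close>

locale standard_brownian_motion = prob_space M
  for M :: "'a measure" and B :: "real \<Rightarrow> 'a \<Rightarrow> real" +
  assumes random_variable: "\<And>t. 0 \<le> t \<Longrightarrow> B t \<in> borel_measurable M"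
    and start: "\<And>\<omega>. \<omega> \<in> space M \<Longrightarrow> B 0 \<omega> = 0"
    and indep_increments: "\<And>(t :: nat \<Rightarrow> real) n. 0 \<le> t 0 \<Longrightarrow> (\<And>i. i < n \<Longrightarrow> t i \<le> t (Suc i)) \<Longrightarrow>
      indep_vars (\<lambda>_. borel) (\<lambda>i \<omega>. B (t (Suc i)) \<omega> - B (t i) \<omega>) {..<n}"
    and normal_increments: "\<And>s t. 0 \<le> s \<Longrightarrow> s < t \<Longrightarrow>
      distributed M lborel (\<lambda>\<omega>. B t \<omega> - B s \<omega>) (normal_density 0 (sqrt (t - s)))"
    and continuous_paths: "\<And>\<omega>. \<omega> \<in> space M \<Longrightarrow> continuous_on {0..} (\<lambda>t. B t \<omega>)"

definition kinetic_BM :: "(real \<Rightarrow> 'a \<Rightarrow> real) \<Rightarrow> real \<Rightarrow> real \<times> complex \<Rightarrow> 'a \<Rightarrow> real \<times> complex" where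
  "kinetic_BM B t x \<omega> =
    (fst x + B t \<omega>, snd x + cis (fst x) * (LINT s:{0..t}|lborel. cis (B s \<omega>)))"

definition kinetic_semigroup ::
  "'a measure \<Rightarrow> (real \<Rightarrow> 'a \<Rightarrow> real) \<Rightarrow> real \<Rightarrow> (real \<times> complex \<Rightarrow> real) \<Rightarrow> real \<times> complex \<Rightarrow> real" where
  "kinetic_semigroup M B T f x = (LINT \<omega>|M. f (kinetic_BM B T x \<omega>))"

definition tangent_flow ::
  "(real \<Rightarrow> 'a \<Rightarrow> real) \<Rightarrow> real \<Rightarrow> real \<times> complex \<Rightarrow> 'a \<Rightarrow> real \<times> complex \<Rightarrow> real \<times> complex" where
  "tangent_flow B T x \<omega> v = vector_derivative (\<lambda>a. kinetic_BM B T (x + a *\<^sub>R v) \<omega>) (at 0)"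

lemma tangent_flow_eq:
  "tangent_flow B T x \<omega> v =
    (fst v, snd v + \<i> * fst v * cis (fst x) * (LINT s:{0..T}|lborel. cis (B s \<omega>)))"
proof -
  define I where "I = (LINT s:{0..T}|lborel. cis (B s \<omega>))"
  have "((\<lambda>a. exp (\<i> * complex_of_real (fst x + a * fst v))) has_vector_derivative
      (\<i> * fst v) * exp (\<i> * complex_of_real (fst x + 0 * fst v))) (at 0)"
    by (rule field_vector_diff_chain_at[unfolded o_def])
       (auto intro!: derivative_eq_intros simp: has_vector_derivative_def fun_eq_iff scaleR_conv_of_real)
  then have cis: "((\<lambda>a. cis (fst x + a * fst v)) has_vector_derivative
      \<i> * fst v * cis (fst x)) (at 0)"
    by (simp add: cis_conv_exp)
  have fst: "((\<lambda>a. fst x + a * fst v + B T \<omega>) has_vector_derivative fst v) (at 0)"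
    by (auto intro!: derivative_eq_intros simp flip: has_real_derivative_iff_has_vector_derivative)
  have "((\<lambda>a. snd x + a *\<^sub>R snd v + cis (fst x + a * fst v) * I) has_vector_derivative
      snd v + \<i> * fst v * cis (fst x) * I) (at 0)"
    by (rule derivative_eq_intros cis refl | simp)+
  from has_vector_derivative_Pair[OF fst this]
  show ?thesis
    unfolding tangent_flow_def kinetic_BM_def I_def[symmetric]
    by (intro vector_derivative_at) simp
qed

text \<open>\<open>H = L\<^sup>2([0,T], \<real>)\<close>, by representatives: almost everywhere equal functions are not
  identified, but they are not separated by the open sets either, so that \<open>L2_borel T\<close> is the
  pullback of the Borel \<open>\<sigma>\<close>-algebra of \<open>H\<close>.\<close>

definition L2_space :: "real \<Rightarrow> (real \<Rightarrow> real) set" where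
  "L2_space T = {g. set_borel_measurable lborel {0..T} g \<and> set_integrable lborel {0..T} (\<lambda>t. (g t)\<^sup>2)}"

definition L2_dist :: "real \<Rightarrow> (real \<Rightarrow> real) \<Rightarrow> (real \<Rightarrow> real) \<Rightarrow> real" where
  "L2_dist T g k = sqrt (LINT t:{0..T}|lborel. (g t - k t)\<^sup>2)"

definition L2_open :: "real \<Rightarrow> (real \<Rightarrow> real) set \<Rightarrow> bool" where
  "L2_open T U \<longleftrightarrow> U \<subseteq> L2_space T \<and>
    (\<forall>g\<in>U. \<exists>r>0. \<forall>k\<in>L2_space T. L2_dist T g k < r \<longrightarrow> k \<in> U)"

definition L2_borel :: "real \<Rightarrow> (real \<Rightarrow> real) measure" where
  "L2_borel T = sigma (L2_space T) {U. L2_open T U}"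

definition malliavin_derivative ::
  "(real \<Rightarrow> 'a \<Rightarrow> real) \<Rightarrow> real \<Rightarrow> real \<times> complex \<Rightarrow> ('a \<Rightarrow> real \<Rightarrow> real) \<Rightarrow> 'a \<Rightarrow> real \<times> complex" where
  "malliavin_derivative B T x h \<omega> =
    (LINT t:{0..T}|lborel. h \<omega> t,
     \<i> * cis (fst x) *
       (LINT t:{0..T}|lborel. cis (B t \<omega>) * complex_of_real (LINT s:{0..t}|lborel. h \<omega> s)))"

definition bounded_C1 :: "(real \<times> complex \<Rightarrow> real) \<Rightarrow> bool" where
  "bounded_C1 f \<longleftrightarrow> bounded (range f) \<and>
    (\<exists>f' :: real \<times> complex \<Rightarrow> (real \<times> complex) \<Rightarrow>\<^sub>L real.
      (\<forall>x. (f has_derivative blinfun_apply (f' x)) (at x)) \<and>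
      continuous_on UNIV f' \<and> bounded (range f'))"

text \<open>Integrability of the left-hand side is part of the duality relation: the Bochner integral of
  a non-integrable function is \<open>0\<close> by convention.\<close>

definition malliavin_dual ::
  "'a measure \<Rightarrow> (real \<Rightarrow> 'a \<Rightarrow> real) \<Rightarrow> real \<Rightarrow> real \<times> complex \<Rightarrow>
    ('a \<Rightarrow> real \<Rightarrow> real) \<Rightarrow> ('a \<Rightarrow> real) \<Rightarrow> bool" where
  "malliavin_dual M B T x h Y \<longleftrightarrow>
    h \<in> measurable M (L2_borel T) \<and> integrable M Y \<and>
    (\<forall>f. bounded_C1 f \<longrightarrow>
      integrable M (\<lambda>\<omega>. frechet_derivative f (at (kinetic_BM B T x \<omega>)) (malliavin_derivative B T x h \<omega>)) \<and>
      (LINT \<omega>|M. frechet_derivative f (at (kinetic_BM B T x \<omega>)) (malliavin_derivative B T x h \<omega>)) =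
      (LINT \<omega>|M. f (kinetic_BM B T x \<omega>) * Y \<omega>))"

definition malliavin_domain ::
  "'a measure \<Rightarrow> (real \<Rightarrow> 'a \<Rightarrow> real) \<Rightarrow> real \<Rightarrow> real \<times> complex \<Rightarrow> ('a \<Rightarrow> real \<Rightarrow> real) set" where
  "malliavin_domain M B T x = {h. \<exists>Y. malliavin_dual M B T x h Y}"

text \<open>The dual of \<open>h\<close> is not unique, since the duality relation only determines its conditional
  expectation given \<open>kinetic_BM B T x\<close>; hence a predicate on operators.\<close>

definition malliavin_duality_operator ::
  "'a measure \<Rightarrow> (real \<Rightarrow> 'a \<Rightarrow> real) \<Rightarrow> real \<Rightarrow> real \<times> complex \<Rightarrow>
    (('a \<Rightarrow> real \<Rightarrow> real) \<Rightarrow> 'a \<Rightarrow> real) \<Rightarrow> bool" where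
  "malliavin_duality_operator M B T x \<delta> \<longleftrightarrow>
    (\<forall>h\<in>malliavin_domain M B T x. malliavin_dual M B T x h (\<delta> h))"

end

theory Submission
  imports Defs
begin

text \<open>For each \<open>\<omega>\<close> the function \<open>y \<mapsto> f (X\<^sub>T\<^sup>y)\<close> is differentiable with derivative \<open>df \<circ> J\<^sub>T\<^sup>y\<close>, which is bounded
  uniformly in \<open>\<omega>\<close> because \<open>f\<close> is Lipschitz and the time integral of \<open>cis (B s)\<close> has norm at most
  \<open>T\<close>. Dominated convergence therefore gives
  \<open>d\<^sub>xP\<^sub>Tf v = E[df (J\<^sub>T\<^sup>x v)] = - E[df (\<D>X\<^sub>T\<^sup>x h)]\<close>, and duality concludes.\<close>

section \<open>Differentiation under the integral sign\<close>

text \<open>Composing with the line \<open>t \<mapsto> x + t w\<close> makes the remainder one of a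
  single real variable. The steps \<open>1 / (n + 1)\<close> form a sequence, as a measurability
  argument by pointwise limits requires.\<close>

lemma has_derivative_difference_quotient:
  assumes "(g has_derivative g') (at x)"
  shows "(\<lambda>n. real (Suc n) *\<^sub>R (g (x + (1 / real (Suc n)) *\<^sub>R w) - g x)) \<longlonglongrightarrow> g' w"
proof -
  have "((\<lambda>t. x + t *\<^sub>R w) has_derivative (\<lambda>t. t *\<^sub>R w)) (at (0::real))"
    by (auto intro!: derivative_eq_intros)
  from has_derivative_compose[OF this, of g g'] assms
  have "((\<lambda>t. (1 / norm t) *\<^sub>R (g (x + t *\<^sub>R w) - (g x + g' (t *\<^sub>R w)))) \<longlongrightarrow> 0) (at (0::real))"
    by (simp add: has_derivative_within inverse_eq_divide)
  moreover have "filterlim (\<lambda>n. 1 / real (Suc n)) (at 0) sequentially"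
    using LIMSEQ_inverse_real_of_nat by (simp add: filterlim_at inverse_eq_divide)
  ultimately have "(\<lambda>n. (1 / norm (1 / real (Suc n))) *\<^sub>R
      (g (x + (1 / real (Suc n)) *\<^sub>R w) - (g x + g' ((1 / real (Suc n)) *\<^sub>R w)))) \<longlonglongrightarrow> 0"
    by (rule filterlim_compose)
  then have "(\<lambda>n. real (Suc n) *\<^sub>R (g (x + (1 / real (Suc n)) *\<^sub>R w) - g x) - g' w) \<longlonglongrightarrow> 0"
    using linear_scale[OF has_derivative_linear[OF assms]]
    by (simp add: algebra_simps del: of_nat_Suc)
  then show ?thesis
    by (rule LIM_zero_cancel)
qed

text \<open>Each difference quotient is a combination of two measurable functions of
  \<open>\<omega>\<close>, and a pointwise limit of a sequence of measurable functions is
  measurable.\<close>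

lemma borel_measurable_has_derivative:
  fixes g :: "'b::real_normed_vector \<Rightarrow> 'a \<Rightarrow> 'c::{banach, second_countable_topology}"
  assumes "\<And>y. g y \<in> borel_measurable M"
    and "\<And>\<omega>. \<omega> \<in> space M \<Longrightarrow> ((\<lambda>y. g y \<omega>) has_derivative g' \<omega>) (at x)"
  shows "(\<lambda>\<omega>. g' \<omega> w) \<in> borel_measurable M"
  by (rule borel_measurable_LIMSEQ_metric[OF _ has_derivative_difference_quotient[OF assms(2)]])
     (use assms(1) in auto)

text \<open>The bound \<open>L\<close> holds at every \<open>y\<close>, so the mean value inequality
  makes \<open>g y \<omega>\<close> Lipschitz in \<open>y\<close> with constant
  \<open>L \<omega>\<close>. This dominates the normalised remainder and yields a full Frechet
  derivative, not only directional ones.\<close>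

lemma has_derivative_lebesgue_integral:
  fixes g :: "'b::real_normed_vector \<Rightarrow> 'a \<Rightarrow> 'c::{banach, second_countable_topology}"
  assumes g: "\<And>y. integrable M (g y)"
    and L: "integrable M L"
    and deriv: "\<And>y \<omega>. \<omega> \<in> space M \<Longrightarrow> ((\<lambda>y. g y \<omega>) has_derivative g' y \<omega>) (at y)"
    and bound: "\<And>y \<omega> w. \<omega> \<in> space M \<Longrightarrow> norm (g' y \<omega> w) \<le> L \<omega> * norm w"
  shows "((\<lambda>y. LINT \<omega>|M. g y \<omega>) has_derivative (\<lambda>w. LINT \<omega>|M. g' x \<omega> w)) (at x)"
proof -
  have [measurable]: "g y \<in> borel_measurable M" for y
    using g by simp
  have [measurable]: "(\<lambda>\<omega>. g' x \<omega> w) \<in> borel_measurable M" for w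
    by (rule borel_measurable_has_derivative[OF _ deriv]) auto
  have int: "integrable M (\<lambda>\<omega>. g' x \<omega> w)" for w
    by (rule Bochner_Integration.integrable_bound[of M "\<lambda>\<omega>. L \<omega> * norm w"])
       (use L bound in \<open>auto intro!: AE_I2 order_trans[OF _ abs_ge_self]\<close>)
  have linear: "linear (g' x \<omega>)" if "\<omega> \<in> space M" for \<omega>
    using deriv[OF that] by (rule has_derivative_linear)
  have lipschitz: "norm (g y \<omega> - g x \<omega>) \<le> L \<omega> * norm (y - x)" if "\<omega> \<in> space M" for y \<omega>
  \<comment> \<open>The mean value inequality needs \<open>0 \<le> L \<omega>\<close>. This follows
    from \<open>bound\<close> at the nonzero vector \<open>y - x\<close>; for \<open>y = x\<close>
    both sides vanish.\<close>
  proof (cases "y = x")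
    case False
    have "0 \<le> L \<omega> * norm (y - x)"
      using bound[OF that] norm_ge_zero by (rule order_trans[rotated])
    then have "0 \<le> L \<omega>"
      using False by (simp add: zero_le_mult_iff)
    then show ?thesis
      using that bound
      by (intro differentiable_bound[OF convex_UNIV]) (auto intro!: deriv onorm_bound)
  qed simp
  have "bounded_linear (\<lambda>w. LINT \<omega>|M. g' x \<omega> w)"
  proof (rule bounded_linear_intro[of _ "LINT \<omega>|M. L \<omega>"])
    show "(LINT \<omega>|M. g' x \<omega> (v + w)) = (LINT \<omega>|M. g' x \<omega> v) + (LINT \<omega>|M. g' x \<omega> w)" for v w
      by (simp add: int linear_add[OF linear] flip: Bochner_Integration.integral_add
          cong: Bochner_Integration.integral_cong)
    show "(LINT \<omega>|M. g' x \<omega> (r *\<^sub>R w)) = r *\<^sub>R (LINT \<omega>|M. g' x \<omega> w)" for r w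
      by (simp add: linear_scale[OF linear] flip: integral_scaleR_right
          cong: Bochner_Integration.integral_cong)
    show "norm (LINT \<omega>|M. g' x \<omega> w) \<le> norm w * (LINT \<omega>|M. L \<omega>)" for w
    proof -
      have "norm (LINT \<omega>|M. g' x \<omega> w) \<le> (LINT \<omega>|M. L \<omega> * norm w)"
        using L by (intro order_trans[OF integral_norm_bound] integral_mono integrable_norm int bound) auto
      then show ?thesis by (simp add: mult.commute)
    qed
  qed
  moreover have "((\<lambda>y. norm ((LINT \<omega>|M. g y \<omega>) - (LINT \<omega>|M. g x \<omega>) - (LINT \<omega>|M. g' x \<omega> (y - x)))
      / norm (y - x)) \<longlongrightarrow> 0) (at x)"
    \<comment> \<open>Dominated convergence concerns sequences, so the limit at \<open>x\<close> is
      tested along arbitrary sequences that avoid \<open>x\<close>.\<close>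
    unfolding tendsto_at_iff_sequentially o_def
  proof (intro allI impI)
    fix X :: "nat \<Rightarrow> 'b"
    assume X: "\<forall>n. X n \<in> UNIV - {x}" "X \<longlonglongrightarrow> x"
    define R where "R n \<omega> = (1 / norm (X n - x)) *\<^sub>R (g (X n) \<omega> - g x \<omega> - g' x \<omega> (X n - x))" for n \<omega>
    have "(\<lambda>n. LINT \<omega>|M. R n \<omega>) \<longlonglongrightarrow> (LINT \<omega>|M. 0)"
    \<comment> \<open>One \<open>L \<omega>\<close> pays for the increment of \<open>g\<close>, the
      other for the linear term.\<close>
    proof (rule integral_dominated_convergence[where w = "\<lambda>\<omega>. 2 * L \<omega>"])
      show "AE \<omega> in M. (\<lambda>n. R n \<omega>) \<longlonglongrightarrow> 0"
      proof (rule AE_I2)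
        fix \<omega> assume "\<omega> \<in> space M"
        then have "((\<lambda>y. (1 / norm (y - x)) *\<^sub>R (g y \<omega> - g x \<omega> - g' x \<omega> (y - x))) \<longlongrightarrow> 0) (at x)"
          using deriv[of \<omega> x] by (simp add: has_derivative_within inverse_eq_divide diff_diff_eq)
        then show "(\<lambda>n. R n \<omega>) \<longlonglongrightarrow> 0"
          using X unfolding R_def tendsto_at_iff_sequentially o_def by blast
      qed
      show "AE \<omega> in M. norm (R n \<omega>) \<le> 2 * L \<omega>" for n
      proof (rule AE_I2)
        fix \<omega> assume "\<omega> \<in> space M"
        then have "norm (g (X n) \<omega> - g x \<omega> - g' x \<omega> (X n - x)) \<le> 2 * L \<omega> * norm (X n - x)"
          using norm_triangle_ineq4[of "g (X n) \<omega> - g x \<omega>" "g' x \<omega> (X n - x)"]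
            lipschitz[of \<omega> "X n"] bound[of \<omega> x "X n - x"] by linarith
        then show "norm (R n \<omega>) \<le> 2 * L \<omega>"
          using X by (simp add: R_def divide_simps)
      qed
    qed (use L in \<open>auto simp: R_def\<close>)
    moreover have "(LINT \<omega>|M. R n \<omega>) = (1 / norm (X n - x)) *\<^sub>R
        ((LINT \<omega>|M. g (X n) \<omega>) - (LINT \<omega>|M. g x \<omega>) - (LINT \<omega>|M. g' x \<omega> (X n - x)))" for n
      by (simp add: R_def g int)
    ultimately show "(\<lambda>n. norm ((LINT \<omega>|M. g (X n) \<omega>) - (LINT \<omega>|M. g x \<omega>) -
        (LINT \<omega>|M. g' x \<omega> (X n - x))) / norm (X n - x)) \<longlonglongrightarrow> 0"
      using tendsto_norm_zero[of "\<lambda>n. LINT \<omega>|M. R n \<omega>"] by simp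
  qed
  ultimately show ?thesis
    unfolding has_derivative_iff_norm by simp
qed

section \<open>Pathwise derivative of the flow\<close>

text \<open>\<open>tangent_flow\<close> is defined along one line only. Its closed form is
  nevertheless the Frechet derivative, since the starting point enters through affine terms and the
  smooth factor \<open>cis (fst y)\<close>, the path integral being constant in
  \<open>y\<close>.\<close>

lemma has_derivative_kinetic_BM:
  "((\<lambda>y. kinetic_BM B T y \<omega>) has_derivative tangent_flow B T y \<omega>) (at y)"
  unfolding kinetic_BM_def[abs_def] tangent_flow_eq[abs_def]
  by (auto intro!: derivative_eq_intros simp: fun_eq_iff scaleR_conv_of_real)

lemma norm_integral_cis_le:
  assumes "0 \<le> T"
  shows "norm (LINT s:{0..T}|lborel. cis (b s)) \<le> T"
  using integral_norm_bound[of lborel "\<lambda>s. indicat_real {0..T} s *\<^sub>R cis (b s)"] assms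
  by (simp add: set_lebesgue_integral_def)

text \<open>The two components of \<open>w\<close> contribute \<open>norm w\<close> each, the
  rotated path integral at most \<open>T * norm w\<close>. The bound depends on neither
  \<open>\<omega>\<close> nor \<open>y\<close>.\<close>

lemma norm_tangent_flow_le:
  assumes "0 \<le> T"
  shows "norm (tangent_flow B T y \<omega> w) \<le> (2 + T) * norm w"
proof -
  define I where "I = (LINT s:{0..T}|lborel. cis (B s \<omega>))"
  have I: "norm I \<le> T"
    unfolding I_def using assms by (rule norm_integral_cis_le)
  have "norm (tangent_flow B T y \<omega> w) \<le>
      norm (fst w) + norm (snd w + \<i> * fst w * cis (fst y) * I)"
    unfolding tangent_flow_eq I_def by (rule norm_Pair_le)
  also have "\<dots> \<le> norm (fst w) + (norm (snd w) + norm (fst w) * norm I)"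
    using norm_triangle_ineq[of "snd w" "\<i> * fst w * cis (fst y) * I"]
    by (simp add: norm_mult)
  also have "\<dots> \<le> norm w + (norm w + norm w * T)"
    using norm_fst_le[of "fst w" "snd w"] norm_snd_le[of "snd w" "fst w"] I
    by (intro add_mono mult_mono) auto
  finally show ?thesis
    by (simp add: algebra_simps)
qed

lemma bounded_C1_has_derivative:
  "bounded_C1 f \<Longrightarrow> (f has_derivative frechet_derivative f (at x)) (at x)"
  unfolding bounded_C1_def by (metis frechet_derivative_at)

lemma bounded_C1_borel_measurable:
  "bounded_C1 f \<Longrightarrow> f \<in> borel_measurable borel"
  by (meson bounded_C1_has_derivative borel_measurable_continuous_onI
      continuous_at_imp_continuous_on has_derivative_continuous)

section \<open>Measurability and derivative of the semigroup\<close>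

context standard_brownian_motion
begin

text \<open>The truncation is there because nothing is known about \<open>B\<close> at negative times.\<close>

lemma borel_measurable_pair:
  "(\<lambda>(t, \<omega>). B (max 0 t) \<omega>) \<in> borel_measurable (lborel \<Otimes>\<^sub>M M)"
proof (rule borel_measurable_LIMSEQ_real)
  \<comment> \<open>Time is rounded down to the grid of mesh \<open>1 / (n + 1)\<close> and cut off
    at 0. Only countably many of the variables \<open>B t\<close> then occur, so joint measurability
    can be checked for each grid index separately.\<close>
  define d where "d n t = max 0 (of_int \<lfloor>real (Suc n) * t\<rfloor> / real (Suc n))" for n and t :: real
  show "(\<lambda>p. B (d n (fst p)) (snd p)) \<in> borel_measurable (lborel \<Otimes>\<^sub>M M)" for n
  proof -
    have "(\<lambda>p. B (max 0 (of_int k / real (Suc n))) (snd p)) \<in> borel_measurable (lborel \<Otimes>\<^sub>M M)" for k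
      using random_variable[of "max 0 (of_int k / real (Suc n))"] by measurable
    then show ?thesis
      unfolding d_def
      by (rule measurable_compose_countable[where g = "\<lambda>p. \<lfloor>real (Suc n) * fst p\<rfloor>"]) measurable
  qed
  fix p assume "p \<in> space (lborel \<Otimes>\<^sub>M M :: (real \<times> 'a) measure)"
  then have \<omega>: "snd p \<in> space M"
    by (auto simp: space_pair_measure)
  have "(\<lambda>n. of_int \<lfloor>real (Suc n) * t\<rfloor> / real (Suc n)) \<longlonglongrightarrow> t" for t :: real
  proof (rule real_tendsto_sandwich)
    show "(\<lambda>n. t - 1 / real (Suc n)) \<longlonglongrightarrow> t"
      using tendsto_diff[OF tendsto_const LIMSEQ_inverse_real_of_nat, of t]
      by (simp add: inverse_eq_divide)
    show "\<forall>\<^sub>F n in sequentially. t - 1 / real (Suc n) \<le> of_int \<lfloor>real (Suc n) * t\<rfloor> / real (Suc n)"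
    proof (rule always_eventually, rule allI)
      fix n
      have "t - 1 / real (Suc n) = (real (Suc n) * t - 1) / real (Suc n)"
        by (simp add: diff_divide_distrib del: of_nat_Suc)
      also have "\<dots> \<le> of_int \<lfloor>real (Suc n) * t\<rfloor> / real (Suc n)"
        by (intro divide_right_mono) linarith+
      finally show "t - 1 / real (Suc n) \<le> of_int \<lfloor>real (Suc n) * t\<rfloor> / real (Suc n)" .
    qed
    show "\<forall>\<^sub>F n in sequentially. of_int \<lfloor>real (Suc n) * t\<rfloor> / real (Suc n) \<le> t"
    proof (rule always_eventually, rule allI)
      fix n
      have "of_int \<lfloor>real (Suc n) * t\<rfloor> \<le> real (Suc n) * t"
        by linarith
      then show "of_int \<lfloor>real (Suc n) * t\<rfloor> / real (Suc n) \<le> t"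
        by (simp add: field_simps del: of_nat_Suc)
    qed
  qed auto
  then have "(\<lambda>n. d n (fst p)) \<longlonglongrightarrow> max 0 (fst p)"
    unfolding d_def by (intro tendsto_max tendsto_const)
  \<comment> \<open>Path continuity is known on \<open>{0..}\<close> only; the cut-off keeps the
    grid times and their limit in that set.\<close>
  then have "(\<lambda>n. B (d n (fst p)) (snd p)) \<longlonglongrightarrow> B (max 0 (fst p)) (snd p)"
    by (rule continuous_on_tendsto_compose[OF continuous_paths[OF \<omega>]])
       (auto simp: d_def intro!: always_eventually)
  then show "(\<lambda>n. B (d n (fst p)) (snd p)) \<longlonglongrightarrow> (case p of (t, \<omega>) \<Rightarrow> B (max 0 t) \<omega>)"
    by (simp add: case_prod_beta)
qed

text \<open>The time integral is a parameter integral of a jointly measurable function, as in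
  Fubini's theorem. Truncating the time at 0 changes nothing on \<open>{0..T}\<close>.\<close>

lemma borel_measurable_kinetic_BM:
  assumes "0 \<le> T"
  shows "kinetic_BM B T x \<in> borel_measurable M"
proof -
  note [measurable] = random_variable[OF assms] borel_measurable_pair
  have "(LINT s:{0..T}|lborel. cis (B s \<omega>)) =
      (LINT s|lborel. indicat_real {0..T} s *\<^sub>R cis (B (max 0 s) \<omega>))" for \<omega>
    unfolding set_lebesgue_integral_def
    by (intro Bochner_Integration.integral_cong) (auto simp: indicator_def)
  moreover have "cis \<in> borel_measurable borel"
    by (intro borel_measurable_continuous_onI continuous_intros)
  then have "(\<lambda>(s, \<omega>). indicat_real {0..T} s *\<^sub>R cis (B (max 0 s) \<omega>)) \<in>
      borel_measurable (lborel \<Otimes>\<^sub>M M)"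
    using measurable_compose[OF borel_measurable_pair]
    by (auto simp: case_prod_beta intro!: borel_measurable_scaleR)
  then have "(\<lambda>\<omega>. LINT s|lborel. indicat_real {0..T} s *\<^sub>R cis (B (max 0 s) \<omega>)) \<in> borel_measurable M"
    by measurable
  ultimately have [measurable]: "(\<lambda>\<omega>. LINT s:{0..T}|lborel. cis (B s \<omega>)) \<in> borel_measurable M"
    by simp
  show ?thesis
    unfolding kinetic_BM_def[abs_def] by measurable
qed

lemma has_derivative_kinetic_semigroup:
  assumes "0 \<le> T" and "bounded_C1 f"
  shows "(kinetic_semigroup M B T f has_derivative
    (\<lambda>w. LINT \<omega>|M. frechet_derivative f (at (kinetic_BM B T x \<omega>)) (tangent_flow B T x \<omega> w))) (at x)"
proof -
  obtain f' :: "real \<times> complex \<Rightarrow> (real \<times> complex) \<Rightarrow>\<^sub>L real"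
    where f': "\<And>x. (f has_derivative blinfun_apply (f' x)) (at x)" and bdd: "bounded (range f')"
    using assms(2) unfolding bounded_C1_def by blast
  obtain K where K: "\<And>x. norm (f' x) \<le> K"
    using bdd by (auto simp: bounded_iff)
  obtain C where C: "\<And>x. norm (f x) \<le> C"
    using assms(2) unfolding bounded_C1_def by (auto simp: bounded_iff)
  note [measurable] = bounded_C1_borel_measurable[OF assms(2)]
  note [measurable] = borel_measurable_kinetic_BM[OF assms(1)]
  have fr: "frechet_derivative f (at y) = f' y" for y
    using frechet_derivative_at[OF f'] by simp
  have "((\<lambda>y. LINT \<omega>|M. f (kinetic_BM B T y \<omega>)) has_derivative
      (\<lambda>w. LINT \<omega>|M. f' (kinetic_BM B T x \<omega>) (tangent_flow B T x \<omega> w))) (at x)"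
  \<comment> \<open>\<open>K\<close> bounds the operator norm of the derivative of \<open>f\<close>,
    and \<open>2 + T\<close> comes from \<open>norm_tangent_flow_le\<close>. A constant is
    integrable under a probability measure.\<close>
  proof (rule has_derivative_lebesgue_integral[where L = "\<lambda>_. K * (2 + T)"])
    show "integrable M (\<lambda>\<omega>. f (kinetic_BM B T y \<omega>))" for y
      by (rule integrable_const_bound[where B = C]) (use C in auto)
    show "((\<lambda>y. f (kinetic_BM B T y \<omega>)) has_derivative
        (\<lambda>w. f' (kinetic_BM B T y \<omega>) (tangent_flow B T y \<omega> w))) (at y)" for y \<omega>
      by (rule has_derivative_compose[OF has_derivative_kinetic_BM f'])
    show "norm (f' (kinetic_BM B T y \<omega>) (tangent_flow B T y \<omega> w)) \<le> K * (2 + T) * norm w" for y \<omega> w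
    proof -
      have "norm (f' (kinetic_BM B T y \<omega>) (tangent_flow B T y \<omega> w)) \<le>
          norm (f' (kinetic_BM B T y \<omega>)) * norm (tangent_flow B T y \<omega> w)"
        by (rule norm_blinfun)
      also have "\<dots> \<le> K * ((2 + T) * norm w)"
        using norm_tangent_flow_le[OF assms(1), of B y \<omega> w] K order_trans[OF norm_ge_zero K]
        by (intro mult_mono) (auto simp del: split_paired_All)
      finally show ?thesis by (simp add: mult.assoc)
    qed
  qed simp
  then show ?thesis
    unfolding kinetic_semigroup_def[abs_def] fr .
qed

end

theorem proposition2p1:
  fixes M :: "'a measure" and B :: "real \<Rightarrow> 'a \<Rightarrow> real"
    and T :: real and x v :: "real \<times> complex" and f :: "real \<times> complex \<Rightarrow> real"
    and \<delta> :: "('a \<Rightarrow> real \<Rightarrow> real) \<Rightarrow> 'a \<Rightarrow> real" and h :: "'a \<Rightarrow> real \<Rightarrow> real"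
  assumes "standard_brownian_motion M B"
    and "T > 0"
    and "bounded_C1 f"
    and "malliavin_duality_operator M B T x \<delta>"
    and "h \<in> malliavin_domain M B T x"
    and "AE \<omega> in M. tangent_flow B T x \<omega> v + malliavin_derivative B T x h \<omega> = 0"
  shows "kinetic_semigroup M B T f differentiable (at x) \<and>
    frechet_derivative (kinetic_semigroup M B T f) (at x) v =
      - (LINT \<omega>|M. f (kinetic_BM B T x \<omega>) * \<delta> h \<omega>)"
proof -
  interpret standard_brownian_motion M B by fact
  let ?df = "\<lambda>\<omega>. frechet_derivative f (at (kinetic_BM B T x \<omega>))"
  let ?D = "\<lambda>w. LINT \<omega>|M. ?df \<omega> (tangent_flow B T x \<omega> w)"
  have deriv: "(kinetic_semigroup M B T f has_derivative ?D) (at x)"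
    using assms(2,3) by (intro has_derivative_kinetic_semigroup) auto
  \<comment> \<open>The duality relation is tested with \<open>f\<close> itself.\<close>
  have dual: "integrable M (\<lambda>\<omega>. ?df \<omega> (malliavin_derivative B T x h \<omega>))"
    "(LINT \<omega>|M. ?df \<omega> (malliavin_derivative B T x h \<omega>)) =
      (LINT \<omega>|M. f (kinetic_BM B T x \<omega>) * \<delta> h \<omega>)"
    using assms(3-5) unfolding malliavin_duality_operator_def malliavin_dual_def by blast+
  note df = bounded_C1_has_derivative[OF assms(3)]
  have "linear (?df \<omega>)" for \<omega>
    using df by (rule has_derivative_linear)
  then have ae: "AE \<omega> in M. ?df \<omega> (tangent_flow B T x \<omega> v) = - ?df \<omega> (malliavin_derivative B T x h \<omega>)"
    using assms(6) by (auto simp: linear_neg simp flip: eq_neg_iff_add_eq_0 elim!: AE_mp)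
  have "?D v = (LINT \<omega>|M. - ?df \<omega> (malliavin_derivative B T x h \<omega>))"
  \<comment> \<open>The integrands agree only almost everywhere, so both must be measurable. The
    right one is integrable by duality; the left one is a directional derivative of
    \<open>y \<mapsto> f (kinetic_BM B T y \<omega>)\<close>, hence a limit of measurable
    quotients.\<close>
  proof (rule integral_cong_AE)
    show "(\<lambda>\<omega>. ?df \<omega> (tangent_flow B T x \<omega> v)) \<in> borel_measurable M"
      using assms(2) bounded_C1_borel_measurable[OF assms(3)]
      by (intro borel_measurable_has_derivative[OF _ has_derivative_compose[OF has_derivative_kinetic_BM df]]
          measurable_compose[OF borel_measurable_kinetic_BM]) auto
  qed (use ae dual(1) in auto)
  then have "?D v = - (LINT \<omega>|M. f (kinetic_BM B T x \<omega>) * \<delta> h \<omega>)"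
    by (simp add: dual)
  then show ?thesis
    using differentiableI[OF deriv] by (simp flip: frechet_derivative_at[OF deriv])
qed

end
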